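(* For every integer $n\ge 2$, the complete graph $K_n$ admits an $\varepsilon$-factorization for some $\varepsilon$ with \[ \varepsilon \le \begin{cases} 0, & n\equiv 1 \pmod 4,\\[1mm] \dfrac{1}{n}, & n\equiv 0 \pmod 4,\\[2mm] \dfrac{1}{n}, & n\equiv 2 \pmod 4,\\[2mm] \dfrac{n+1}{n^2}, & n\equiv 3 \pmod 4. \end{cases} \]
   Context: All graphs are finite, simple (no loops, no multiple edges) and undirected; $N_H(u)$ denotes the set of neighbours of $u$ in $H$. Let $0\le\varepsilon\le 1$ and let $G$ be a simple graph on $n$ vertices. $G$ admits an $\varepsilon$-factorization if there exist simple graphs $H$ and $K$ on the vertex set $V(G)$ and a set of ordered pairs $\mathcal E\subseteq V(G)\times V(G)$ with $|\mathcal E|\le \varepsilon n^2$ such that, for every $(u,v)\in (V(G)\times V(G))\setminus\mathcal E$ (including pairs with $u=v$), $|N_H(u)\cap N_K(v)|=1$ if $uv\in E(G)$ and $|N_H(u)\cap N_K(v)|=0$ otherwise. Equivalently, for a common ordering of the vertices, the adjacency matrices satisfy that $A(H)A(K)$ and $A(G)$ disagree in at most $\varepsilon n^2$ entries. *)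

theory Defs
  imports Complex_Main "Graph_Theory.Kuratowski"
begin

text \<open>
  Finite simple undirected graphs are the symmetric loop-free finite digraphs
  \<^locale>\<open>pair_graph\<close>: an edge \<open>uv\<close> is the pair of arcs \<open>(u, v)\<close>, \<open>(v, u)\<close>.
  Arcs are vertex pairs rather than elements of a separate arc type, so that the
  existential quantification over factors below is not limited by the size of
  an arc type.
\<close>

definition nbrs :: "'a pair_pre_digraph \<Rightarrow> 'a \<Rightarrow> 'a set" where
  "nbrs H u = {w. (u, w) \<in> parcs H}"

definition admits_factorization :: "real \<Rightarrow> 'a pair_pre_digraph \<Rightarrow> bool" where
  "admits_factorization \<epsilon> G \<longleftrightarrow>
     (\<exists>H K \<E>. pair_graph H \<and> pverts H = pverts G \<and>
        pair_graph K \<and> pverts K = pverts G \<and>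
        \<E> \<subseteq> pverts G \<times> pverts G \<and>
        real (card \<E>) \<le> \<epsilon> * (real (card (pverts G)))\<^sup>2 \<and>
        (\<forall>(u, v) \<in> (pverts G \<times> pverts G) - \<E>.
           card (nbrs H u \<inter> nbrs K v) = (if (u, v) \<in> parcs G then 1 else 0)))"

end

theory Submission
  imports Defs
begin

text \<open>
  Take \<open>{0..<n}\<close> as the vertex set and write \<open>J\<close> for the all-ones matrix. Two explicit products
  come within \<open>n\<close> entries of \<open>J - I\<close>, the adjacency matrix of \<open>K\<^sub>n\<close>.

  For even \<open>n\<close>, let \<open>P\<close> be the adjacency matrix of a perfect matching and let the second factor be
  the complement \<open>J - I - P\<close> of that matching. Since \<open>P\<^sup>2 = I\<close> and \<open>P J = J\<close>, the product is
  \<open>P (J - I - P) = J - P - I\<close>, which is wrong exactly at the \<open>n\<close> ones of \<open>P\<close>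
  (lemma \<open>card_matching_common\<close>).

  For odd \<open>n\<close>, the first factor is the Hamiltonian cycle \<open>0, 1, \<dots>, n - 1\<close>, and the second one joins
  \<open>i\<close> and \<open>j\<close> when \<open>\<bar>i - j\<bar>\<close> lies in two consecutive classes modulo 4. The two neighbours of \<open>i\<close> on
  the cycle have distances \<open>\<bar>i - j\<bar> - 1\<close> and \<open>\<bar>i - j\<bar> + 1\<close> from \<open>j\<close>, and of two numbers that differ
  by 2 exactly one lies in the chosen pair of classes; hence all entries off the diagonal are 1. For
  this to survive the step from \<open>n - 1\<close> back to \<open>0\<close>, the pair of classes has to be invariant under
  \<open>d \<mapsto> n - d\<close>; for it to give a loop-free graph, the pair must not contain 0. When
  \<open>n \<equiv> 1 (mod 4)\<close> the pair is \<open>{2, 3}\<close>, and as it does not contain 1, the diagonal of the product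
  vanishes and the product is exactly \<open>J - I\<close>. When \<open>n \<equiv> 3 (mod 4)\<close> the pair is \<open>{1, 2}\<close>, the
  diagonal entries are 2, and the product is \<open>J + I\<close>, which is wrong at \<open>n\<close> entries only
  (lemma \<open>card_cycle_common\<close>).
\<close>

section \<open>Factors given by relations on an initial segment\<close>

lemma pair_graph_pullback:
  assumes "finite V"
    and "\<And>x y. x \<in> V \<Longrightarrow> y \<in> V \<Longrightarrow> R (g x) (g y) \<Longrightarrow> R (g y) (g x)"
    and "\<And>x. x \<in> V \<Longrightarrow> \<not> R (g x) (g x)"
  shows "pair_graph \<lparr>pverts = V, parcs = {(x, y). x \<in> V \<and> y \<in> V \<and> R (g x) (g y)}\<rparr>"
proof unfold_locales
  have "{(x, y). x \<in> V \<and> y \<in> V \<and> R (g x) (g y)} \<subseteq> V \<times> V" by auto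
  with \<open>finite V\<close> show "finite (parcs \<lparr>pverts = V,
      parcs = {(x, y). x \<in> V \<and> y \<in> V \<and> R (g x) (g y)}\<rparr>)"
    by (simp add: finite_subset)
  show "symmetric (with_proj \<lparr>pverts = V,
      parcs = {(x, y). x \<in> V \<and> y \<in> V \<and> R (g x) (g y)}\<rparr>)"
    unfolding symmetric_def by (rule symI) (use assms(2) in simp)
qed (use assms(1,3) in auto)

text \<open>
  Factorizations are invariant under relabelling of the vertices, so that both factors may be
  given as relations on \<open>{0..<n}\<close>. The error set is the graph of a partial function because the
  constructions below have at most one wrong entry in each row.
\<close>

lemma admits_factorization_complete_digraphI:
  fixes G :: "'a pair_pre_digraph" and P Q :: "nat \<Rightarrow> nat \<Rightarrow> bool"
  assumes G: "complete_digraph n (with_proj G)"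
    and P_sym: "\<And>i j. i < n \<Longrightarrow> j < n \<Longrightarrow> P i j \<Longrightarrow> P j i"
    and P_irrefl: "\<And>i. i < n \<Longrightarrow> \<not> P i i"
    and Q_sym: "\<And>i j. i < n \<Longrightarrow> j < n \<Longrightarrow> Q i j \<Longrightarrow> Q j i"
    and Q_irrefl: "\<And>i. i < n \<Longrightarrow> \<not> Q i i"
    and S: "S \<subseteq> {..<n}" "\<And>i. i \<in> S \<Longrightarrow> f i < n" "real (card S) \<le> \<epsilon> * (real n)\<^sup>2"
    and common: "\<And>i j. i < n \<Longrightarrow> j < n \<Longrightarrow> \<not> (i \<in> S \<and> j = f i) \<Longrightarrow>
      card {w. w < n \<and> P i w \<and> Q j w} = (if i \<noteq> j then 1 else 0)"
  shows "admits_factorization \<epsilon> G"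
proof -
  define V where "V = pverts G"
  have "finite V" and "card V = n" and arcs: "parcs G = {(u, v). u \<in> V \<and> v \<in> V \<and> u \<noteq> v}"
    using G by (auto simp: complete_digraph_pair_def V_def)
  then obtain g where g: "bij_betw g V {..<n}"
    using ex_bij_betw_finite_nat[of V] by (auto simp: atLeast0LessThan)
  have g_less: "g x < n" if "x \<in> V" for x
    using that g by (auto simp: bij_betw_def)
  have g_eq_iff: "g x = g y \<longleftrightarrow> x = y" if "x \<in> V" "y \<in> V" for x y
    using that g by (auto simp: bij_betw_def dest: inj_onD)
  define h where "h = inv_into V g"
  have h: "h i \<in> V" "g (h i) = i" if "i < n" for i
    using that g by (auto simp: h_def bij_betw_def inv_into_into f_inv_into_f)
  define pull where "pull R = \<lparr>pverts = V, parcs = {(x, y). x \<in> V \<and> y \<in> V \<and> R (g x) (g y)}\<rparr>"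
    for R :: "nat \<Rightarrow> nat \<Rightarrow> bool"
  have nbrs_pull: "nbrs (pull R) u = {w \<in> V. R (g u) (g w)}" if "u \<in> V" for R u
    using that by (auto simp: nbrs_def pull_def)
  have card_common: "card (nbrs (pull P) u \<inter> nbrs (pull Q) v) =
      card {w. w < n \<and> P (g u) w \<and> Q (g v) w}" if "u \<in> V" "v \<in> V" for u v
  proof (rule bij_betw_same_card)
    have "inj_on g {w \<in> V. P (g u) (g w) \<and> Q (g v) (g w)}"
      using g by (auto simp: bij_betw_def inj_on_def)
    moreover have "g ` {w \<in> V. P (g u) (g w) \<and> Q (g v) (g w)} =
        {w. w < n \<and> P (g u) w \<and> Q (g v) w}"
      using g by (auto simp: bij_betw_def)
    moreover have "nbrs (pull P) u \<inter> nbrs (pull Q) v =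
        {w \<in> V. P (g u) (g w) \<and> Q (g v) (g w)}"
      using that by (auto simp: nbrs_pull)
    ultimately show "bij_betw g (nbrs (pull P) u \<inter> nbrs (pull Q) v)
        {w. w < n \<and> P (g u) w \<and> Q (g v) w}"
      by (simp add: bij_betw_def)
  qed
  define E where "E = (\<lambda>i. (h i, h (f i))) ` S"
  have "finite S" using S(1) by (rule finite_subset) simp
  then have card_E: "card E \<le> card S" unfolding E_def by (rule card_image_le)
  have entry: "card (nbrs (pull P) u \<inter> nbrs (pull Q) v) = (if (u, v) \<in> parcs G then 1 else 0)"
    if "u \<in> V" "v \<in> V" "(u, v) \<notin> E" for u v
  proof -
    have "\<not> (g u \<in> S \<and> g v = f (g u))"
    proof
      assume *: "g u \<in> S \<and> g v = f (g u)"
      have "h (g u) = u" "h (g v) = v"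
        using that g by (auto simp: h_def bij_betw_def)
      with * have "(u, v) \<in> E" by (force simp: E_def)
      with that show False by simp
    qed
    then show ?thesis
      using that common[of "g u" "g v"] by (simp add: card_common g_less g_eq_iff arcs)
  qed
  have "pair_graph (pull P)"
    unfolding pull_def using \<open>finite V\<close> P_sym P_irrefl g_less by (intro pair_graph_pullback) simp_all
  moreover have "pair_graph (pull Q)"
    unfolding pull_def using \<open>finite V\<close> Q_sym Q_irrefl g_less by (intro pair_graph_pullback) simp_all
  moreover have "pverts (pull R) = V" for R by (simp add: pull_def)
  moreover have "E \<subseteq> V \<times> V" using S(1,2) h by (auto simp: E_def)
  moreover have "real (card E) \<le> \<epsilon> * (real (card V))\<^sup>2"
    using card_E S(3) \<open>card V = n\<close> by simp
  ultimately show ?thesis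
    unfolding admits_factorization_def V_def[symmetric]
    using entry by (intro exI[of _ "pull P"] exI[of _ "pull Q"] exI[of _ E]) auto
qed

section \<open>Even order: a perfect matching and its complement\<close>

definition mate :: "nat \<Rightarrow> nat" where
  "mate i = (if even i then i + 1 else i - 1)"

lemma mate_mate [simp]: "mate (mate i) = i"
  by (auto simp: mate_def)

lemma mate_neq [simp]: "mate i \<noteq> i"
  by (auto simp: mate_def elim: oddE)

lemma mate_less: "even n \<Longrightarrow> i < n \<Longrightarrow> mate i < n"
  unfolding mate_def by presburger

text \<open>
  The only candidate for a common neighbour is \<open>mate i\<close>, and it is lost when \<open>j\<close> is \<open>i\<close>, as
  desired, but also when \<open>j\<close> is \<open>mate i\<close>.
\<close>

lemma card_matching_common:
  assumes "even n" "i < n" "j \<noteq> mate i"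
  shows "card {w. w < n \<and> w = mate i \<and> w \<noteq> j \<and> w \<noteq> mate j} = (if i \<noteq> j then 1 else 0)"
proof -
  have "mate i = mate j \<longleftrightarrow> i = j" by (metis mate_mate)
  then have "{w. w < n \<and> w = mate i \<and> w \<noteq> j \<and> w \<noteq> mate j} = (if i \<noteq> j then {mate i} else {})"
    using assms mate_less[of n i] by auto
  then show ?thesis by simp
qed

lemma admits_factorization_even:
  assumes "complete_digraph n (with_proj G)" "even n" "n > 0"
  shows "admits_factorization (1 / real n) G"
proof (rule admits_factorization_complete_digraphI[where S = "{..<n}" and f = mate
      and P = "\<lambda>i w. w = mate i" and Q = "\<lambda>j w. w \<noteq> j \<and> w \<noteq> mate j"])
  show "real (card {..<n}) \<le> 1 / real n * (real n)\<^sup>2"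
    using \<open>n > 0\<close> by (simp add: power2_eq_square)
  show "card {w. w < n \<and> w = mate i \<and> w \<noteq> j \<and> w \<noteq> mate j} = (if i \<noteq> j then 1 else 0)"
    if "i < n" "j < n" "\<not> (i \<in> {..<n} \<and> j = mate i)" for i j
    using that \<open>even n\<close> by (intro card_matching_common) auto
  show "mate i < n" if "i \<in> {..<n}" for i
    using that \<open>even n\<close> mate_less by simp
  show "j \<noteq> i \<and> j \<noteq> mate i \<Longrightarrow> i \<noteq> j \<and> i \<noteq> mate j" for i j
    by (metis mate_mate)
qed (use assms(1) in \<open>simp_all add: mate_neq[symmetric]\<close>)

section \<open>Odd order: a Hamiltonian cycle and distances modulo 4\<close>

text \<open>As subtraction of natural numbers truncates, this is \<open>\<bar>i - j\<bar>\<close>.\<close>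

definition gap :: "nat \<Rightarrow> nat \<Rightarrow> nat" where
  "gap i j = (i - j) + (j - i)"

definition cycle_adj :: "nat \<Rightarrow> nat \<Rightarrow> nat \<Rightarrow> bool" where
  "cycle_adj n i j \<longleftrightarrow> gap i j = 1 \<or> gap i j = n - 1"

text \<open>
  For odd \<open>n\<close> the classes of \<open>gap i j\<close> modulo 4 that give an edge are 2 and 3 if
  \<open>n \<equiv> 1 (mod 4)\<close>, and 1 and 2 if \<open>n \<equiv> 3 (mod 4)\<close>. These are the pairs of consecutive classes
  that are invariant under \<open>d \<mapsto> n - d\<close> and omit 0.
\<close>

definition mod4_edge :: "nat \<Rightarrow> nat \<Rightarrow> bool" where
  "mod4_edge n d \<longleftrightarrow> d mod 4 \<in> (if n mod 4 = 1 then {2, 3} else {1, 2})"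

definition mod4_adj :: "nat \<Rightarrow> nat \<Rightarrow> nat \<Rightarrow> bool" where
  "mod4_adj n i j \<longleftrightarrow> mod4_edge n (gap i j)"

lemma mod4_edge_shift: "mod4_edge n (d + 2) \<longleftrightarrow> \<not> mod4_edge n d"
proof -
  have "(d + 2) mod 4 = (d mod 4 + 2) mod 4" by (simp add: mod_simps)
  moreover have "d mod 4 = 0 \<or> d mod 4 = 1 \<or> d mod 4 = 2 \<or> d mod 4 = 3" by presburger
  ultimately show ?thesis by (auto simp: mod4_edge_def)
qed

lemma mod4_edge_reflect:
  assumes "odd n" "a + b = n"
  shows "mod4_edge n a \<longleftrightarrow> mod4_edge n b"
proof -
  have "n mod 4 = (a mod 4 + b mod 4) mod 4" using \<open>a + b = n\<close> by (simp add: mod_simps)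
  moreover have "n mod 4 = 1 \<or> n mod 4 = 3" using \<open>odd n\<close> by presburger
  moreover have "a mod 4 = 0 \<or> a mod 4 = 1 \<or> a mod 4 = 2 \<or> a mod 4 = 3" by presburger
  moreover have "b mod 4 = 0 \<or> b mod 4 = 1 \<or> b mod 4 = 2 \<or> b mod 4 = 3" by presburger
  ultimately show ?thesis by (auto simp: mod4_edge_def)
qed

lemma gap_commute: "gap i j = gap j i"
  by (simp add: gap_def)

lemma gap_self [simp]: "gap i i = 0"
  by (simp add: gap_def)

definition cycle_succ :: "nat \<Rightarrow> nat \<Rightarrow> nat" where
  "cycle_succ n i = (if i = n - 1 then 0 else i + 1)"

definition cycle_pred :: "nat \<Rightarrow> nat \<Rightarrow> nat" where
  "cycle_pred n i = (if i = 0 then n - 1 else i - 1)"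

lemma cycle_adj_iff:
  assumes "i < n" "w < n"
  shows "cycle_adj n i w \<longleftrightarrow> w = cycle_succ n i \<or> w = cycle_pred n i"
  using assms unfolding cycle_adj_def gap_def cycle_succ_def cycle_pred_def by auto

lemma cycle_succ_neq_pred: "n \<ge> 3 \<Longrightarrow> cycle_succ n i \<noteq> cycle_pred n i"
  by (auto simp: cycle_succ_def cycle_pred_def)

text \<open>
  The distances of \<open>i - 1\<close> and \<open>i + 1\<close> from \<open>j\<close> differ by 2, so that exactly one of them is in the
  chosen pair of classes. If \<open>i\<close> is an end of the path \<open>0, 1, \<dots>, n - 1\<close>, one of the distances is
  replaced by its difference from \<open>n\<close>, which does not change membership in the pair.
\<close>

lemma mod4_adj_succ_neq_pred:
  assumes "odd n" "i < n" "j < n" "i \<noteq> j"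
  shows "mod4_adj n j (cycle_succ n i) \<noteq> mod4_adj n j (cycle_pred n i)"
proof -
  define d where "d = gap i j - 1"
  have opposite: "mod4_edge n (d + 2) \<noteq> mod4_edge n d"
    using mod4_edge_shift by blast
  consider "i = 0" | "i = n - 1" "i \<noteq> 0" | "i \<noteq> 0" "i \<noteq> n - 1" by blast
  then show ?thesis
  proof cases
    case 1
    with assms have "gap j (cycle_succ n i) = d" "gap j (cycle_pred n i) + (d + 2) = n"
      by (auto simp: gap_def cycle_succ_def cycle_pred_def d_def)
    with mod4_edge_reflect[OF \<open>odd n\<close> this(2)] opposite show ?thesis
      by (auto simp only: mod4_adj_def)
  next
    case 2
    with assms have "gap j (cycle_pred n i) = d" "gap j (cycle_succ n i) + (d + 2) = n"
      by (auto simp: gap_def cycle_succ_def cycle_pred_def d_def)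
    with mod4_edge_reflect[OF \<open>odd n\<close> this(2)] opposite show ?thesis
      by (auto simp only: mod4_adj_def)
  next
    case 3
    then have "cycle_succ n i = i + 1" "cycle_pred n i = i - 1"
      by (simp_all add: cycle_succ_def cycle_pred_def)
    moreover have "gap j (i + 1) = d \<and> gap j (i - 1) = d + 2" if "i < j"
      using that 3 by (simp add: gap_def d_def)
    moreover have "gap j (i + 1) = d + 2 \<and> gap j (i - 1) = d" if "j < i"
      using that 3 by (simp add: gap_def d_def)
    moreover have "i < j \<or> j < i" using \<open>i \<noteq> j\<close> by auto
    ultimately show ?thesis
      using opposite unfolding mod4_adj_def by auto
  qed
qed

lemma mod4_adj_self_neighbours:
  assumes "odd n" "n \<ge> 3" "i < n"
  shows "mod4_adj n i (cycle_succ n i) \<longleftrightarrow> n mod 4 = 3"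
    and "mod4_adj n i (cycle_pred n i) \<longleftrightarrow> n mod 4 = 3"
proof -
  have "n mod 4 = 1 \<or> n mod 4 = 3" using \<open>odd n\<close> by presburger
  then have one: "mod4_edge n 1 \<longleftrightarrow> n mod 4 = 3" by (auto simp: mod4_edge_def)
  have "mod4_edge n (n - 1) \<longleftrightarrow> mod4_edge n 1"
    using assms by (intro mod4_edge_reflect) auto
  moreover have "gap i (cycle_succ n i) = 1 \<or> gap i (cycle_succ n i) = n - 1"
    "gap i (cycle_pred n i) = 1 \<or> gap i (cycle_pred n i) = n - 1"
    using assms by (auto simp: gap_def cycle_succ_def cycle_pred_def)
  ultimately show "mod4_adj n i (cycle_succ n i) \<longleftrightarrow> n mod 4 = 3"
    and "mod4_adj n i (cycle_pred n i) \<longleftrightarrow> n mod 4 = 3"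
    using one unfolding mod4_adj_def by metis+
qed

lemma card_cycle_common:
  assumes "odd n" "n \<ge> 3" "i < n" "j < n"
  shows "card {w. w < n \<and> cycle_adj n i w \<and> mod4_adj n j w} =
    (if i \<noteq> j then 1 else if n mod 4 = 3 then 2 else 0)"
proof -
  let ?s = "cycle_succ n i" and ?p = "cycle_pred n i"
  have "?s < n" "?p < n" using assms by (auto simp: cycle_succ_def cycle_pred_def)
  then have "{w. w < n \<and> cycle_adj n i w \<and> mod4_adj n j w} =
      (if mod4_adj n j ?s then {?s} else {}) \<union> (if mod4_adj n j ?p then {?p} else {})"
    using assms by (auto simp: cycle_adj_iff)
  then show ?thesis
    using assms mod4_adj_succ_neq_pred[of n i j] mod4_adj_self_neighbours[of n i]
      cycle_succ_neq_pred[of n i]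
    by (cases "i = j") auto
qed

lemma admits_factorization_odd:
  assumes "complete_digraph n (with_proj G)" "odd n" "n \<ge> 3"
  shows "admits_factorization (if n mod 4 = 1 then 0 else 1 / real n) G"
proof (rule admits_factorization_complete_digraphI[where f = "\<lambda>i. i"
      and S = "if n mod 4 = 1 then {} else {..<n}" and P = "cycle_adj n" and Q = "mod4_adj n"])
  show "real (card (if n mod 4 = 1 then {} else {..<n})) \<le>
      (if n mod 4 = 1 then 0 else 1 / real n) * (real n)\<^sup>2"
    using \<open>n \<ge> 3\<close> by (simp add: power2_eq_square)
  show "card {w. w < n \<and> cycle_adj n i w \<and> mod4_adj n j w} = (if i \<noteq> j then 1 else 0)"
    if "i < n" "j < n" "\<not> (i \<in> (if n mod 4 = 1 then {} else {..<n}) \<and> j = i)" for i j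
    using that assms(2,3) by (auto simp: card_cycle_common split: if_splits)
qed (use assms in \<open>auto simp: cycle_adj_def mod4_adj_def mod4_edge_def gap_commute split: if_splits\<close>)

section \<open>Complete graphs\<close>

theorem theorem3:
  fixes n :: nat and G :: "'a pair_pre_digraph"
  assumes "n \<ge> 2"
    and "complete_digraph n (with_proj G)"
  shows "\<exists>\<epsilon>::real. 0 \<le> \<epsilon> \<and> \<epsilon> \<le> 1 \<and>
    \<epsilon> \<le> (if n mod 4 = 1 then 0
         else if n mod 4 = 0 then 1 / real n
         else if n mod 4 = 2 then 1 / real n
         else (real n + 1) / (real n)\<^sup>2) \<and>
    admits_factorization \<epsilon> G"
proof (cases "even n")
  case True
  then have "n mod 4 = 0 \<or> n mod 4 = 2" by presburger
  then show ?thesis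
    using assms True admits_factorization_even[of n G] by (intro exI[of _ "1 / real n"]) auto
next
  case False
  with \<open>n \<ge> 2\<close> have "n \<ge> 3" and "n mod 4 = 1 \<or> n mod 4 = 3" by presburger+
  moreover have "1 / real n \<le> (real n + 1) / (real n)\<^sup>2"
    using \<open>n \<ge> 2\<close> by (simp add: field_simps power2_eq_square)
  ultimately show ?thesis
    using assms False admits_factorization_odd[of n G]
    by (intro exI[of _ "if n mod 4 = 1 then 0 else 1 / real n"]) auto
qed

end
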